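(* Let $N\ge1$, $\sigma>0$, $c>0$ and $h\ge0$ be fixed. Let $Z_1,\dots,Z_N$ be i.i.d. standard normal random variables and, for $\kappa\in\mathbb{R}$, let $S_0(\kappa)=0$, $S_n(\kappa)=\sigma\sum_{i=1}^nZ_i-\kappa\sigma\sqrt n$ for $n\ge 1$, and $L_N(\kappa)=\max_{0\le n\le N}S_n(\kappa)$. For $p>c$ define the optimal objective values of the lost-sales model and of the backorder model, with common production (purchasing) cost $c$, common holding cost $h$, and lost-sales and backlog penalty costs both equal to $p$, by $$V_{\mathrm{LS}}(p)=\inf_{\kappa\in\mathbb{R}}\Bigl(\sigma\sqrt N\,(c+h)\kappa+(p+h)\,\mathbf{E}[L_N(\kappa)]\Bigr),$$ $$V_{\mathrm{BO}}(p)=\sigma\sqrt N\ \inf_{\kappa\in\mathbb{R}}\bigl[(c+h)\kappa+(p+h)G(\kappa)\bigr].$$ Then, as $p\to\infty$, $$\frac{V_{\mathrm{LS}}(p)}{V_{\mathrm{BO}}(p)}\to1 .$$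
   Context: $\phi$ and $\Phi$ are the standard normal density and distribution functions, $\bar\Phi:=1-\Phi$, and $G(x):=\mathbf{E}[(Z-x)^+]=\phi(x)-x\bar\Phi(x)$ for $Z$ standard normal. In both models the cumulative supply up to period $n$ equals the cumulative mean demand plus $\kappa\sigma\sqrt n$ (i.e. $\alpha=\tfrac12$), $L_N(\kappa)$ is the cumulative lost sales, and in the backorder model the backlog and inventory at the end of period $n$ are $S_n^+$ and $S_n^-$. The objectives are the paper's reduced forms, in which per-period costs are scaled by $1/N$ and the factor $2/3$ arising from $\frac1N\sum_{n=1}^N\sqrt n\approx\frac23\sqrt N$ is absorbed into the holding and backlog cost parameters. *)

theory Defs
  imports "HOL-Probability.Probability"
begin

text \<open>
  Expected excess of a standard normal variable over the level \<open>x\<close>.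
\<close>

definition normal_loss :: "real \<Rightarrow> real" where
  "normal_loss x = (\<integral>z. max (z - x) 0 \<partial>std_normal_distribution)"

text \<open>
  Cumulative demand minus cumulative supply after \<open>n\<close> periods; for \<open>n = 0\<close> the sum is empty
  and \<open>sqrt 0 = 0\<close>, so the value is \<open>0\<close>.
\<close>

definition excess_demand :: "real \<Rightarrow> (nat \<Rightarrow> 'a \<Rightarrow> real) \<Rightarrow> real \<Rightarrow> nat \<Rightarrow> 'a \<Rightarrow> real" where
  "excess_demand \<sigma> Z \<kappa> n \<omega> = \<sigma> * (\<Sum>i=1..n. Z i \<omega>) - \<kappa> * \<sigma> * sqrt (real n)"

definition cum_lost_sales :: "real \<Rightarrow> (nat \<Rightarrow> 'a \<Rightarrow> real) \<Rightarrow> nat \<Rightarrow> real \<Rightarrow> 'a \<Rightarrow> real" where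
  "cum_lost_sales \<sigma> Z N \<kappa> \<omega> = Max ((\<lambda>n. excess_demand \<sigma> Z \<kappa> n \<omega>) ` {0..N})"

text \<open>
  Both infima below are infima of reals. For \<open>p > c > 0\<close> and \<open>h \<ge> 0\<close>, with \<open>Z\<close> i.i.d. standard
  normal, the objectives are bounded below, so these are genuine greatest lower bounds; for other
  values of \<open>p\<close> the value is immaterial.
\<close>

definition V_LS ::
  "'a measure \<Rightarrow> (nat \<Rightarrow> 'a \<Rightarrow> real) \<Rightarrow> nat \<Rightarrow> real \<Rightarrow> real \<Rightarrow> real \<Rightarrow> real \<Rightarrow> real" where
  "V_LS M Z N \<sigma> c h p =
    (INF \<kappa>. \<sigma> * sqrt (real N) * (c + h) * \<kappa>
            + (p + h) * (\<integral>\<omega>. cum_lost_sales \<sigma> Z N \<kappa> \<omega> \<partial>M))"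

definition V_BO :: "nat \<Rightarrow> real \<Rightarrow> real \<Rightarrow> real \<Rightarrow> real \<Rightarrow> real" where
  "V_BO N \<sigma> c h p =
    \<sigma> * sqrt (real N) * (INF \<kappa>. (c + h) * \<kappa> + (p + h) * normal_loss \<kappa>)"

end

theory Submission
  imports Defs
begin

text \<open>
  Put \<open>a = c + h\<close>, \<open>q = p + h\<close>, \<open>s = \<sigma> * sqrt N\<close>, and write \<open>G\<close> for \<^const>\<open>normal_loss\<close>.
  Since \<open>\<Sum>i=1..n. Z i\<close> has the law of \<open>sqrt n\<close> times a standard normal variable, the positive
  part of the excess demand after \<open>n\<close> periods has expectation \<open>\<sigma> * sqrt n * G \<kappa>\<close>. The lost sales
  are at least the positive part for \<open>n = N\<close> and at most the sum of all \<open>N\<close> positive parts, so their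
  expectation lies between \<open>s * G \<kappa>\<close> and \<open>N * s * G \<kappa>\<close>. Thus the lost-sales model is squeezed
  between the backorder model and the same model with its penalty multiplied by \<open>N\<close>.

  That factor \<open>N\<close> is harmless because the Gaussian tail is so thin: increasing \<open>\<kappa> \<ge> 0\<close> by a fixed
  \<open>\<delta>\<close> divides \<open>G\<close> by at least \<open>exp (\<delta>\<^sup>2 / 2)\<close> (\<open>normal_loss_shift_le\<close>), which absorbs the
  factor \<open>N\<close>, while the linear cost grows only by \<open>a * \<delta>\<close>. Hence
  \<open>V_BO \<le> V_LS \<le> V_BO + s * a * \<delta>\<close> for all large \<open>p\<close> (\<open>cheap_shift_absorbs_factor\<close> is the
  deterministic core). The gap is bounded, and \<open>V_BO\<close> tends to infinity
  (\<open>newsvendor_cost_eventually_ge\<close>), so the ratio tends to \<open>1\<close>.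
\<close>

section \<open>The expected excess of a standard normal variable\<close>

lemma prob_space_std_normal: "prob_space std_normal_distribution"
  by (rule prob_space_normal_density) simp

lemma integrable_std_normal_id: "integrable std_normal_distribution (\<lambda>z. z)"
  using integrable_std_normal_distribution_moment[of 1] by simp

lemma integrable_normal_excess: "integrable std_normal_distribution (\<lambda>z. max (z - x) 0)"
proof -
  interpret prob_space std_normal_distribution by (rule prob_space_std_normal)
  show ?thesis
    by (intro integrable_max Bochner_Integration.integrable_diff integrable_std_normal_id) auto
qed

lemma normal_loss_antimono: "x \<le> y \<Longrightarrow> normal_loss y \<le> normal_loss x"
  unfolding normal_loss_def by (intro integral_mono integrable_normal_excess) auto

lemma normal_loss_ge_minus: "- x \<le> normal_loss x"
proof -
  interpret prob_space std_normal_distribution by (rule prob_space_std_normal)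
  have "(\<integral>z. z - x \<partial>std_normal_distribution) \<le> normal_loss x"
    unfolding normal_loss_def
    by (intro integral_mono integrable_normal_excess
        Bochner_Integration.integrable_diff integrable_std_normal_id) auto
  moreover have "(\<integral>z. z - x \<partial>std_normal_distribution) = - x"
    using integral_std_normal_distribution_moment_odd[of 1] prob_space
    by (simp add: integrable_std_normal_id)
  ultimately show ?thesis by simp
qed

lemma normal_loss_pos: "0 < normal_loss x"
proof (rule ccontr)
  assume "\<not> 0 < normal_loss x"
  moreover have "0 \<le> normal_loss x"
    unfolding normal_loss_def by (intro integral_nonneg_AE) auto
  ultimately have "normal_loss x = 0" by simp
  then have "(\<integral>z. max (z - x) 0 \<partial>std_normal_distribution) = 0"
    by (simp only: normal_loss_def)
  then have "AE z in std_normal_distribution. max (z - x) 0 = 0"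
    by (subst (asm) integral_nonneg_eq_0_iff_AE[OF integrable_normal_excess]) auto
  then have "AE z in lborel. max (z - x) 0 = 0"
    by (subst (asm) AE_density) (auto simp: normal_density_pos)
  then have "AE z in lborel. z \<notin> {x<..<x + 1}"
    by eventually_elim auto
  then have "emeasure lborel {x<..<x + 1} = 0"
    by (subst (asm) AE_iff_measurable[where N = "{x<..<x + 1}"]) auto
  then show False by simp
qed

lemma normal_loss_nonneg: "0 \<le> normal_loss x"
  using normal_loss_pos[of x] by simp

lemma normal_loss_lborel:
  "normal_loss x = (\<integral>z. std_normal_density z * max (z - x) 0 \<partial>lborel)"
  unfolding normal_loss_def by (subst integral_density) auto

lemma integrable_normal_excess_lborel:
  "integrable lborel (\<lambda>z. std_normal_density z * max (z - x) 0)"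
  using integrable_normal_excess[of x] by (subst (asm) integrable_density) auto

text \<open>
  After the substitution \<open>z = u + \<delta>\<close> the two expectations differ only in the density, and
  \<open>\<phi>(u + \<delta>) = \<phi>(u) * exp (- u * \<delta> - \<delta>\<^sup>2 / 2)\<close>, where \<open>u \<ge> x \<ge> 0\<close> wherever the integrand is
  nonzero.
\<close>

lemma normal_loss_shift_le:
  assumes "0 \<le> x" and "0 \<le> \<delta>"
  shows "normal_loss (x + \<delta>) \<le> exp (- \<delta>\<^sup>2 / 2) * normal_loss x"
proof -
  have shifted: "(\<lambda>u. std_normal_density (\<delta> + 1 * u) * max (\<delta> + 1 * u - (x + \<delta>)) 0)
      = (\<lambda>u. std_normal_density (\<delta> + u) * max (u - x) 0)"
    by (simp add: algebra_simps)
  have "normal_loss (x + \<delta>) = (\<integral>u. std_normal_density (\<delta> + u) * max (u - x) 0 \<partial>lborel)"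
    unfolding normal_loss_lborel
    by (subst lborel_integral_real_affine[of 1 _ \<delta>], simp, simp only: shifted) simp
  also have "\<dots> \<le> (\<integral>u. exp (- \<delta>\<^sup>2 / 2) * (std_normal_density u * max (u - x) 0) \<partial>lborel)"
  proof (rule integral_mono)
    show "integrable lborel (\<lambda>u. std_normal_density (\<delta> + u) * max (u - x) 0)"
      using lborel_integrable_real_affine[OF integrable_normal_excess_lborel[of "x + \<delta>"], of 1 \<delta>]
      by (simp only: shifted)
    show "integrable lborel (\<lambda>u. exp (- \<delta>\<^sup>2 / 2) * (std_normal_density u * max (u - x) 0))"
      by (intro integrable_mult_right integrable_normal_excess_lborel)
    fix u :: real
    show "std_normal_density (\<delta> + u) * max (u - x) 0
        \<le> exp (- \<delta>\<^sup>2 / 2) * (std_normal_density u * max (u - x) 0)"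
    proof (cases "u \<le> x")
      case False
      then have "0 \<le> \<delta> * u" using assms by simp
      then have "- (\<delta> + u)\<^sup>2 / 2 \<le> - \<delta>\<^sup>2 / 2 + - u\<^sup>2 / 2"
        by (simp add: power2_sum field_simps)
      then have "exp (- (\<delta> + u)\<^sup>2 / 2) \<le> exp (- \<delta>\<^sup>2 / 2) * exp (- u\<^sup>2 / 2)"
        by (simp only: exp_add[symmetric] exp_le_cancel_iff)
      then have "std_normal_density (\<delta> + u) \<le> exp (- \<delta>\<^sup>2 / 2) * std_normal_density u"
        by (simp add: std_normal_density_def divide_right_mono)
      then have "std_normal_density (\<delta> + u) * max (u - x) 0
          \<le> (exp (- \<delta>\<^sup>2 / 2) * std_normal_density u) * max (u - x) 0"
        by (rule mult_right_mono) simp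
      then show ?thesis by (simp only: mult.assoc)
    qed simp
  qed
  also have "\<dots> = exp (- \<delta>\<^sup>2 / 2) * normal_loss x"
    by (simp add: normal_loss_lborel)
  finally show ?thesis .
qed

section \<open>The deterministic newsvendor cost\<close>

text \<open>
  A negative \<open>\<kappa>\<close> saves linear cost, but \<open>\<kappa> + G \<kappa> \<ge> 0\<close> shows that \<open>a\<close> of the \<open>q\<close> units of
  penalty weight pay for that saving.
\<close>

lemma newsvendor_cost_ge:
  assumes "0 \<le> a" and "a \<le> q" and "\<kappa> \<le> b"
  shows "(q - a) * normal_loss b \<le> a * \<kappa> + q * normal_loss \<kappa>"
proof -
  have "(q - a) * normal_loss b \<le> (q - a) * normal_loss \<kappa>"
    using assms by (intro mult_left_mono normal_loss_antimono) auto
  moreover have "0 \<le> a * (\<kappa> + normal_loss \<kappa>)"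
    using assms normal_loss_ge_minus[of \<kappa>] by (intro mult_nonneg_nonneg) auto
  ultimately show ?thesis by (simp add: algebra_simps)
qed

lemma newsvendor_cost_nonneg:
  assumes "0 \<le> a" and "a \<le> q"
  shows "0 \<le> a * \<kappa> + q * normal_loss \<kappa>"
proof -
  have "0 \<le> (q - a) * normal_loss \<kappa>"
    using assms normal_loss_nonneg by simp
  also have "\<dots> \<le> a * \<kappa> + q * normal_loss \<kappa>"
    using assms by (intro newsvendor_cost_ge) auto
  finally show ?thesis .
qed

text \<open>
  The linear cost alone reaches \<open>B\<close> once \<open>\<kappa> \<ge> B / a\<close>; below that level the loss is bounded away
  from \<open>0\<close>, so a large penalty does.
\<close>

lemma newsvendor_cost_eventually_ge:
  assumes "0 < a"
  shows "eventually (\<lambda>q. \<forall>\<kappa>. B \<le> a * \<kappa> + q * normal_loss \<kappa>) at_top"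
proof -
  define b where "b = B / a"
  have "eventually (\<lambda>q. max a (a + B / normal_loss b) \<le> q) at_top"
    by (rule eventually_ge_at_top)
  then show ?thesis
  proof (eventually_elim, intro allI)
    fix q \<kappa> assume "max a (a + B / normal_loss b) \<le> q"
    then have q: "a \<le> q" and "B / normal_loss b \<le> q - a" by auto
    then have B: "B \<le> (q - a) * normal_loss b"
      using normal_loss_pos[of b] by (simp add: pos_divide_le_eq)
    show "B \<le> a * \<kappa> + q * normal_loss \<kappa>"
    proof (cases "\<kappa> \<le> b")
      case True
      then show ?thesis using B newsvendor_cost_ge[of a q \<kappa> b] q assms by simp
    next
      case False
      then have "B \<le> a * \<kappa>" using assms by (simp add: b_def field_simps)
      moreover have "0 \<le> q * normal_loss \<kappa>" using q assms normal_loss_nonneg by simp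
      ultimately show ?thesis by simp
    qed
  qed
qed

text \<open>
  For \<open>\<kappa> \<ge> 0\<close> the competitor is \<open>\<kappa> + \<delta>\<close>. A level \<open>\<kappa> < 0\<close> already costs at least
  \<open>q * G 0 / 2\<close>, and there the competitor is \<open>\<delta>\<close> itself; this is why \<open>G\<close> should shrink by
  \<open>2 * r\<close> instead of \<open>r\<close>.
\<close>

lemma cheap_shift_absorbs_factor:
  assumes "0 < a" and "1 \<le> r"
  obtains \<delta> where "\<And>q \<kappa>. 2 * a \<le> q \<Longrightarrow>
      \<exists>\<kappa>'. a * \<kappa>' + r * q * normal_loss \<kappa>' \<le> a * \<kappa> + q * normal_loss \<kappa> + a * \<delta>"
proof
  define \<delta> where "\<delta> = sqrt (2 * ln (2 * r))"
  have "0 \<le> \<delta>" using assms by (simp add: \<delta>_def)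
  have exp_\<delta>: "exp (- \<delta>\<^sup>2 / 2) = 1 / (2 * r)"
    using assms by (simp add: \<delta>_def exp_minus inverse_eq_divide)
  have shrink: "r * normal_loss (x + \<delta>) \<le> normal_loss x / 2" if "0 \<le> x" for x
  proof -
    have "r * normal_loss (x + \<delta>) \<le> r * (1 / (2 * r) * normal_loss x)"
      using normal_loss_shift_le[OF that \<open>0 \<le> \<delta>\<close>] assms exp_\<delta>
      by (intro mult_left_mono) auto
    then show ?thesis using assms by simp
  qed
  fix q \<kappa> assume q: "2 * a \<le> q"
  show "\<exists>\<kappa>'. a * \<kappa>' + r * q * normal_loss \<kappa>' \<le> a * \<kappa> + q * normal_loss \<kappa> + a * \<delta>"
  proof (cases "0 \<le> \<kappa>")
    case True
    have "r * normal_loss (\<kappa> + \<delta>) \<le> normal_loss \<kappa>"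
      using shrink[OF True] normal_loss_nonneg[of \<kappa>] by simp
    then have "q * (r * normal_loss (\<kappa> + \<delta>)) \<le> q * normal_loss \<kappa>"
      using q assms by (intro mult_left_mono) auto
    then show ?thesis
      by (intro exI[of _ "\<kappa> + \<delta>"]) (simp add: algebra_simps)
  next
    case False
    have "q * (r * normal_loss (0 + \<delta>)) \<le> q * (normal_loss 0 / 2)"
      using q assms by (intro mult_left_mono shrink) auto
    also have "\<dots> = q / 2 * normal_loss 0" by simp
    also have "\<dots> \<le> (q - a) * normal_loss 0"
      using q by (intro mult_right_mono normal_loss_nonneg) auto
    also have "\<dots> \<le> a * \<kappa> + q * normal_loss \<kappa>"
      using False q assms by (intro newsvendor_cost_ge) auto
    finally show ?thesis
      by (intro exI[of _ \<delta>]) (simp add: algebra_simps)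
  qed
qed

section \<open>Expected lost sales\<close>

context prob_space
begin

lemma std_normal_excess:
  assumes Y: "distributed M lborel Y std_normal_density"
  shows "integrable M (\<lambda>\<omega>. max (Y \<omega> - x) 0)"
    and "(\<integral>\<omega>. max (Y \<omega> - x) 0 \<partial>M) = normal_loss x"
proof -
  have [measurable]: "Y \<in> borel_measurable M"
    using distributed_measurable[OF Y] by simp
  have law: "distr M lborel Y = std_normal_distribution"
    using Y by (rule distributed_distr_eq_density)
  show "integrable M (\<lambda>\<omega>. max (Y \<omega> - x) 0)"
    using integrable_normal_excess[of x] unfolding law[symmetric]
    by (subst (asm) integrable_distr_eq) auto
  show "(\<integral>\<omega>. max (Y \<omega> - x) 0 \<partial>M) = normal_loss x"
    unfolding normal_loss_def law[symmetric] by (subst integral_distr) auto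
qed

lemma excess_demand_pos_part:
  assumes "0 < \<sigma>" and "1 \<le> n"
    and indep: "indep_vars (\<lambda>_. borel) Z {1..n}"
    and normal: "\<And>i. i \<in> {1..n} \<Longrightarrow> distributed M lborel (Z i) std_normal_density"
  shows "integrable M (\<lambda>\<omega>. max (excess_demand \<sigma> Z \<kappa> n \<omega>) 0)"
    and "(\<integral>\<omega>. max (excess_demand \<sigma> Z \<kappa> n \<omega>) 0 \<partial>M) = \<sigma> * sqrt n * normal_loss \<kappa>"
proof -
  define Y where "Y \<omega> = ((\<Sum>i=1..n. Z i \<omega>) - 0) / sqrt n" for \<omega>
  have "distributed M lborel (\<lambda>\<omega>. \<Sum>i=1..n. Z i \<omega>)
      (normal_density (\<Sum>i=1..n. 0) (sqrt (\<Sum>i=1..n. 1\<^sup>2)))"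
    using assms by (intro sum_indep_normal) auto
  then have Y: "distributed M lborel Y std_normal_density"
    using normal_standard_normal_convert[of "sqrt n" "\<lambda>\<omega>. \<Sum>i=1..n. Z i \<omega>" 0] \<open>1 \<le> n\<close>
    by (simp add: Y_def[abs_def])
  have scaled: "max (excess_demand \<sigma> Z \<kappa> n \<omega>) 0 = \<sigma> * sqrt n * max (Y \<omega> - \<kappa>) 0" for \<omega>
  proof -
    have "excess_demand \<sigma> Z \<kappa> n \<omega> = \<sigma> * sqrt n * (Y \<omega> - \<kappa>)"
      using \<open>1 \<le> n\<close> by (simp add: excess_demand_def Y_def field_simps)
    then show ?thesis
      using \<open>0 < \<sigma>\<close> by (simp add: max_mult_distrib_left)
  qed
  show "integrable M (\<lambda>\<omega>. max (excess_demand \<sigma> Z \<kappa> n \<omega>) 0)"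
    unfolding scaled by (intro integrable_mult_right std_normal_excess[OF Y])
  show "(\<integral>\<omega>. max (excess_demand \<sigma> Z \<kappa> n \<omega>) 0 \<partial>M) = \<sigma> * sqrt n * normal_loss \<kappa>"
    unfolding scaled by (simp add: std_normal_excess[OF Y])
qed

lemma expected_lost_sales_bounds:
  assumes \<sigma>: "0 < \<sigma>" and N: "1 \<le> N"
    and indep: "indep_vars (\<lambda>_. borel) Z {1..N}"
    and normal: "\<And>i. i \<in> {1..N} \<Longrightarrow> distributed M lborel (Z i) std_normal_density"
  shows "\<sigma> * sqrt N * normal_loss \<kappa> \<le> (\<integral>\<omega>. cum_lost_sales \<sigma> Z N \<kappa> \<omega> \<partial>M)"
    and "(\<integral>\<omega>. cum_lost_sales \<sigma> Z N \<kappa> \<omega> \<partial>M) \<le> N * (\<sigma> * sqrt N * normal_loss \<kappa>)"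
proof -
  let ?S = "\<lambda>n \<omega>. max (excess_demand \<sigma> Z \<kappa> n \<omega>) 0"
  have S: "integrable M (?S n)" "(\<integral>\<omega>. ?S n \<omega> \<partial>M) = \<sigma> * sqrt n * normal_loss \<kappa>"
    if "n \<in> {1..N}" for n
    using that \<sigma> normal indep_vars_subset[OF indep, of "{1..n}"]
    by (auto intro!: excess_demand_pos_part)
  \<comment> \<open>The term for \<open>n = 0\<close> makes the maximum nonnegative.\<close>
  have lower: "?S n \<omega> \<le> cum_lost_sales \<sigma> Z N \<kappa> \<omega>" if "n \<in> {1..N}" for n \<omega>
  proof -
    have "excess_demand \<sigma> Z \<kappa> m \<omega> \<le> cum_lost_sales \<sigma> Z N \<kappa> \<omega>" if "m \<le> N" for m
      unfolding cum_lost_sales_def using that by (intro Max_ge) auto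
    from this[of n] this[of 0] that show ?thesis
      by (simp add: excess_demand_def)
  qed
  have upper: "cum_lost_sales \<sigma> Z N \<kappa> \<omega> \<le> (\<Sum>n=1..N. ?S n \<omega>)" for \<omega>
    unfolding cum_lost_sales_def
  proof (rule Max.boundedI; clarsimp)
    fix m assume m: "m \<le> N"
    show "excess_demand \<sigma> Z \<kappa> m \<omega> \<le> (\<Sum>n=Suc 0..N. ?S n \<omega>)"
    proof (cases "m = 0")
      case True
      then show ?thesis by (simp add: excess_demand_def sum_nonneg)
    next
      case False
      have "excess_demand \<sigma> Z \<kappa> m \<omega> \<le> ?S m \<omega>" by simp
      also have "\<dots> \<le> (\<Sum>n=Suc 0..N. ?S n \<omega>)"
        using False m by (intro member_le_sum) auto
      finally show ?thesis .
    qed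
  qed
  have [measurable]: "Z i \<in> borel_measurable M" if "i \<in> {1..N}" for i
    using distributed_measurable[OF normal[OF that]] by simp
  have [measurable]: "cum_lost_sales \<sigma> Z N \<kappa> \<in> borel_measurable M"
    unfolding cum_lost_sales_def[abs_def] excess_demand_def[abs_def]
    by (intro borel_measurable_Max borel_measurable_diff borel_measurable_times
        borel_measurable_sum borel_measurable_const) auto
  have sum_int: "integrable M (\<lambda>\<omega>. \<Sum>n=1..N. ?S n \<omega>)"
    using S by (intro Bochner_Integration.integrable_sum) auto
  have L_int: "integrable M (cum_lost_sales \<sigma> Z N \<kappa>)"
  proof (rule Bochner_Integration.integrable_bound[OF sum_int])
    have "0 \<le> cum_lost_sales \<sigma> Z N \<kappa> \<omega>" for \<omega>
      using lower[of N \<omega>] N by simp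
    then show "AE \<omega> in M. norm (cum_lost_sales \<sigma> Z N \<kappa> \<omega>) \<le> norm (\<Sum>n=1..N. ?S n \<omega>)"
      using upper by (intro AE_I2) (simp add: abs_of_nonneg sum_nonneg)
  qed simp
  have "\<sigma> * sqrt N * normal_loss \<kappa> = (\<integral>\<omega>. ?S N \<omega> \<partial>M)"
    using S(2)[of N] N by simp
  also have "\<dots> \<le> (\<integral>\<omega>. cum_lost_sales \<sigma> Z N \<kappa> \<omega> \<partial>M)"
    using N by (intro integral_mono S(1) L_int lower) auto
  finally show "\<sigma> * sqrt N * normal_loss \<kappa> \<le> (\<integral>\<omega>. cum_lost_sales \<sigma> Z N \<kappa> \<omega> \<partial>M)" .
  have "(\<integral>\<omega>. cum_lost_sales \<sigma> Z N \<kappa> \<omega> \<partial>M) \<le> (\<integral>\<omega>. (\<Sum>n=1..N. ?S n \<omega>) \<partial>M)"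
    by (intro integral_mono L_int sum_int upper)
  also have "\<dots> = (\<Sum>n=1..N. \<integral>\<omega>. ?S n \<omega> \<partial>M)"
    using S(1) by (intro Bochner_Integration.integral_sum) auto
  also have "\<dots> = (\<Sum>n=1..N. \<sigma> * sqrt n * normal_loss \<kappa>)"
    using S(2) by (intro sum.cong refl) auto
  also have "\<dots> \<le> (\<Sum>n=1..N. \<sigma> * sqrt N * normal_loss \<kappa>)"
    using \<sigma> by (intro sum_mono mult_right_mono mult_left_mono normal_loss_nonneg) auto
  also have "\<dots> = N * (\<sigma> * sqrt N * normal_loss \<kappa>)" by simp
  finally show "(\<integral>\<omega>. cum_lost_sales \<sigma> Z N \<kappa> \<omega> \<partial>M) \<le> N * (\<sigma> * sqrt N * normal_loss \<kappa>)" .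
qed

end

section \<open>Comparison of the two models\<close>

lemma V_BO_tendsto_at_top:
  assumes "1 \<le> N" and "0 < \<sigma>" and "0 < c" and "0 \<le> h"
  shows "filterlim (V_BO N \<sigma> c h) at_top at_top"
  unfolding filterlim_at_top
proof
  fix B
  let ?s = "\<sigma> * sqrt (real N)"
  have s: "0 < ?s" using assms by simp
  have "filterlim (\<lambda>p. h + p) at_top at_top"
    by (rule filterlim_tendsto_add_at_top[OF tendsto_const filterlim_ident])
  then have "eventually (\<lambda>p. \<forall>\<kappa>. B / ?s \<le> (c + h) * \<kappa> + (h + p) * normal_loss \<kappa>) at_top"
    using newsvendor_cost_eventually_ge[of "c + h" "B / ?s"] assms
    by (auto simp: filterlim_iff)
  then show "eventually (\<lambda>p. B \<le> V_BO N \<sigma> c h p) at_top"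
  proof eventually_elim
    case (elim p)
    then have "B / ?s \<le> (INF \<kappa>. (c + h) * \<kappa> + (p + h) * normal_loss \<kappa>)"
      by (intro cINF_greatest) (auto simp: add.commute)
    then have "B \<le> (INF \<kappa>. (c + h) * \<kappa> + (p + h) * normal_loss \<kappa>) * ?s"
      unfolding pos_divide_le_eq[OF s] .
    then show ?case unfolding V_BO_def by (simp only: mult.commute)
  qed
qed

lemma (in prob_space) V_LS_minus_V_BO_bounded:
  assumes N: "1 \<le> N" and \<sigma>: "0 < \<sigma>" and c: "0 < c" and h: "0 \<le> h"
    and indep: "indep_vars (\<lambda>_. borel) Z {1..N}"
    and normal: "\<And>i. i \<in> {1..N} \<Longrightarrow> distributed M lborel (Z i) std_normal_density"
  obtains C where "\<And>p. 2 * (c + h) \<le> p + h \<Longrightarrow>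
    V_BO N \<sigma> c h p \<le> V_LS M Z N \<sigma> c h p \<and> V_LS M Z N \<sigma> c h p \<le> V_BO N \<sigma> c h p + C"
proof -
  define a where "a = c + h"
  define s where "s = \<sigma> * sqrt (real N)"
  have a: "0 < a" and s: "0 < s" using assms by (auto simp: a_def s_def)
  let ?EL = "\<lambda>\<kappa>. \<integral>\<omega>. cum_lost_sales \<sigma> Z N \<kappa> \<omega> \<partial>M"
  have EL: "s * normal_loss \<kappa> \<le> ?EL \<kappa>" "?EL \<kappa> \<le> N * (s * normal_loss \<kappa>)" for \<kappa>
    unfolding s_def using expected_lost_sales_bounds[OF \<sigma> N indep normal] by auto
  obtain \<delta> where shift: "\<And>q \<kappa>. 2 * a \<le> q \<Longrightarrow>
      \<exists>\<kappa>'. a * \<kappa>' + real N * q * normal_loss \<kappa>' \<le> a * \<kappa> + q * normal_loss \<kappa> + a * \<delta>"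
    using cheap_shift_absorbs_factor[of a "real N"] a N by auto
  show thesis
  proof
    fix p assume "2 * (c + h) \<le> p + h"
    define q where "q = p + h"
    have q: "2 * a \<le> q" using \<open>2 * (c + h) \<le> p + h\<close> by (simp add: a_def q_def)
    have q0: "0 \<le> q" and aq: "a \<le> q" using q a by auto
    define cost where "cost \<kappa> = a * \<kappa> + q * normal_loss \<kappa>" for \<kappa>
    define LS where "LS \<kappa> = s * a * \<kappa> + q * ?EL \<kappa>" for \<kappa>
    have BO: "V_BO N \<sigma> c h p = s * (INF \<kappa>. cost \<kappa>)"
      by (simp add: V_BO_def cost_def s_def a_def q_def)
    have LS: "V_LS M Z N \<sigma> c h p = (INF \<kappa>. LS \<kappa>)"
      by (simp add: V_LS_def LS_def s_def a_def q_def)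
    have cost_nonneg: "0 \<le> cost \<kappa>" for \<kappa>
      unfolding cost_def using a aq by (intro newsvendor_cost_nonneg) auto
    then have bdd: "bdd_below (range cost)" by (intro bdd_belowI2)
    have cost_le: "s * cost \<kappa> \<le> LS \<kappa>" for \<kappa>
      using mult_left_mono[OF EL(1) q0, of \<kappa>] by (simp add: cost_def LS_def algebra_simps)
    have LS_le: "LS \<kappa> \<le> s * (a * \<kappa> + real N * q * normal_loss \<kappa>)" for \<kappa>
      using mult_left_mono[OF EL(2) q0, of \<kappa>] by (simp add: LS_def algebra_simps)
    have LS_nonneg: "0 \<le> LS \<kappa>" for \<kappa>
      using cost_le[of \<kappa>] mult_nonneg_nonneg[of s "cost \<kappa>"] s cost_nonneg[of \<kappa>] by linarith
    then have bdd_LS: "bdd_below (range LS)" by (intro bdd_belowI2)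
    have "s * (INF \<kappa>. cost \<kappa>) \<le> (INF \<kappa>. LS \<kappa>)"
    proof (rule cINF_greatest)
      fix \<kappa>
      have "s * (INF \<kappa>. cost \<kappa>) \<le> s * cost \<kappa>"
        using s by (intro mult_left_mono cINF_lower[OF bdd]) auto
      also have "\<dots> \<le> LS \<kappa>" by (rule cost_le)
      finally show "s * (INF \<kappa>. cost \<kappa>) \<le> LS \<kappa>" .
    qed simp
    moreover have "(INF \<kappa>. LS \<kappa>) \<le> s * (INF \<kappa>. cost \<kappa>) + s * (a * \<delta>)"
    proof -
      have "(INF \<kappa>. LS \<kappa>) / s - a * \<delta> \<le> (INF \<kappa>. cost \<kappa>)"
      proof (rule cINF_greatest)
        fix \<kappa>
        obtain \<kappa>' where
          "a * \<kappa>' + real N * q * normal_loss \<kappa>' \<le> a * \<kappa> + q * normal_loss \<kappa> + a * \<delta>"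
          using shift[OF q] by blast
        then have "s * (a * \<kappa>' + real N * q * normal_loss \<kappa>') \<le> s * (cost \<kappa> + a * \<delta>)"
          unfolding cost_def using s by (intro mult_left_mono) auto
        moreover have "(INF \<kappa>. LS \<kappa>) \<le> LS \<kappa>'"
          by (intro cINF_lower[OF bdd_LS]) simp
        ultimately have "(INF \<kappa>. LS \<kappa>) \<le> s * (cost \<kappa> + a * \<delta>)"
          using LS_le[of \<kappa>'] by linarith
        then show "(INF \<kappa>. LS \<kappa>) / s - a * \<delta> \<le> cost \<kappa>"
          using s by (simp add: field_simps)
      qed simp
      then show ?thesis using s by (simp add: field_simps)
    qed
    ultimately show "V_BO N \<sigma> c h p \<le> V_LS M Z N \<sigma> c h p \<and>
        V_LS M Z N \<sigma> c h p \<le> V_BO N \<sigma> c h p + s * (a * \<delta>)"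
      by (simp add: BO LS)
  qed
qed

theorem proposition11:
  fixes M :: "'a measure" and Z :: "nat \<Rightarrow> 'a \<Rightarrow> real"
    and N :: nat and \<sigma> c h :: real
  assumes "prob_space M"
    and "N \<ge> 1" and "\<sigma> > 0" and "c > 0" and "h \<ge> 0"
    and "prob_space.indep_vars M (\<lambda>_. borel) Z {1..N}"
    and "\<And>i. i \<in> {1..N} \<Longrightarrow> distributed M lborel (Z i) std_normal_density"
  shows "((\<lambda>p. V_LS M Z N \<sigma> c h p / V_BO N \<sigma> c h p) \<longlongrightarrow> 1) at_top"
proof -
  interpret prob_space M by fact
  let ?BO = "V_BO N \<sigma> c h" and ?LS = "V_LS M Z N \<sigma> c h"
  obtain C where C: "\<And>p. 2 * (c + h) \<le> p + h \<Longrightarrow> ?BO p \<le> ?LS p \<and> ?LS p \<le> ?BO p + C"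
    using V_LS_minus_V_BO_bounded[OF assms(2-7)] by blast
  have BO: "filterlim ?BO at_top at_top"
    using assms by (intro V_BO_tendsto_at_top) auto
  have large: "eventually (\<lambda>p. 0 < ?BO p \<and> ?BO p \<le> ?LS p \<and> ?LS p \<le> ?BO p + C) at_top"
    using filterlim_at_top_dense[THEN iffD1, OF BO, rule_format, of 0]
      eventually_ge_at_top[of "2 * (c + h) - h"]
    by eventually_elim (use C in auto)
  show ?thesis
  proof (rule tendsto_sandwich)
    show "eventually (\<lambda>p. 1 \<le> ?LS p / ?BO p) at_top"
      using large by eventually_elim (auto simp: field_simps)
    show "eventually (\<lambda>p. ?LS p / ?BO p \<le> 1 + C / ?BO p) at_top"
      using large by eventually_elim (auto simp: field_simps)
    have "((\<lambda>p. C / ?BO p) \<longlongrightarrow> 0) at_top"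
      by (rule tendsto_divide_0[OF tendsto_const filterlim_at_top_imp_at_infinity[OF BO]])
    then show "((\<lambda>p. 1 + C / ?BO p) \<longlongrightarrow> 1) at_top"
      using tendsto_add[OF tendsto_const, of _ 0 at_top 1] by simp
  qed simp
qed

end
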